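(* Let $d \geq 1$ be a real number. If $\mathcal{H}$ is a nonempty $2$-uniform hypergraph with degree bound $d$, then $$\frac{|\sigma(\mathcal{H})|}{|\mathcal{H}|} \geq \frac{2}{d}.$$
   Context: A $k$-uniform hypergraph on $[n]=\{1,\ldots,n\}$ ($n$ a positive integer) is a family $\mathcal{H} \subset \binom{[n]}{k}$ of $k$-element subsets of $[n]$, called hyperedges; $|\mathcal{H}|$ is the number of hyperedges. The shadow of $\mathcal{H}$ is $\sigma(\mathcal{H}) = \{S \in \binom{[n]}{k-1} : \exists H \in \mathcal{H},\ S \subset H\}$. The maximum degree is $\Delta(\mathcal{H}) = \max_{v \in [n]} |\{H \in \mathcal{H} : v \in H\}|$, and a degree bound of $\mathcal{H}$ is any real number $d$ with $\Delta(\mathcal{H}) \leq d$. *)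

theory Defs
  imports Complex_Main "HOL-Library.Ramsey"
begin

definition uniform_hypergraph :: "nat \<Rightarrow> nat \<Rightarrow> nat set set \<Rightarrow> bool" where
  "uniform_hypergraph n k H \<longleftrightarrow> n \<ge> 1 \<and> H \<subseteq> nsets {1..n} k"

(* The strict inclusion also gives the empty shadow for k = 0, where k - 1 truncates to 0. *)
definition shadow :: "nat \<Rightarrow> nat \<Rightarrow> nat set set \<Rightarrow> nat set set" where
  "shadow n k H = {S \<in> nsets {1..n} (k - 1). \<exists>E\<in>H. S \<subset> E}"

definition degree :: "nat set set \<Rightarrow> nat \<Rightarrow> nat" where
  "degree H v = card {E \<in> H. v \<in> E}"

definition max_degree :: "nat \<Rightarrow> nat set set \<Rightarrow> nat" where
  "max_degree n H = Max (degree H ` {1..n})"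

definition degree_bound :: "nat \<Rightarrow> nat set set \<Rightarrow> real \<Rightarrow> bool" where
  "degree_bound n H d \<longleftrightarrow> real (max_degree n H) \<le> d"

end

theory Submission
  imports Defs
begin

text \<open>
  A graph is a 2-uniform hypergraph, and its shadow consists of the singletons of its non-isolated
  vertices. Counting the incident pairs of a vertex and an edge in two ways gives twice the
  number of edges on one side, and on the other a sum of degrees over the non-isolated vertices,
  which is at most \<open>d\<close> times their number. So \<open>2 * card H \<le> d * card (shadow n 2 H)\<close>, and
  dividing by \<open>d * card H\<close> gives the claim. The two ingredients are the lemmas
  \<open>sum_degree_uniform\<close> and \<open>card_shadow_graph\<close>.
\<close>

lemma uniform_hypergraphD:
  assumes "uniform_hypergraph n k H"
  shows "finite H" "\<Union>H \<subseteq> {1..n}" "finite (\<Union>H)" "E \<in> H \<Longrightarrow> card E = k"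
proof -
  have H: "H \<subseteq> nsets {1..n} k"
    using assms by (simp add: uniform_hypergraph_def)
  show "finite H"
    using H by (rule finite_subset) (simp add: finite_imp_finite_nsets)
  show U: "\<Union>H \<subseteq> {1..n}"
    using H by (auto simp: nsets_def)
  show "finite (\<Union>H)"
    using U by (rule finite_subset) simp
  show "E \<in> H \<Longrightarrow> card E = k"
    using H by (auto simp: nsets_def)
qed

text \<open>Both sides count the pairs \<open>(v, E)\<close> with \<open>v \<in> E \<in> H\<close>: each edge lies in \<open>k\<close> of them.\<close>

lemma sum_degree_uniform:
  assumes "uniform_hypergraph n k H"
  shows "(\<Sum>v\<in>\<Union>H. degree H v) = k * card H"
  unfolding degree_def
proof (rule sum_multicount)
  show "\<forall>E\<in>H. card {v \<in> \<Union>H. v \<in> E} = k"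
  proof
    fix E assume "E \<in> H"
    then have "{v \<in> \<Union>H. v \<in> E} = E" by blast
    then show "card {v \<in> \<Union>H. v \<in> E} = k"
      using uniform_hypergraphD(4)[OF assms \<open>E \<in> H\<close>] by simp
  qed
qed (use uniform_hypergraphD[OF assms] in auto)

text \<open>A singleton inside an edge is a proper subset of it because the edge has two elements.\<close>

lemma card_shadow_graph:
  assumes "uniform_hypergraph n 2 H"
  shows "card (shadow n 2 H) = card (\<Union>H)"
proof -
  have "shadow n 2 H = (\<lambda>v. {v}) ` \<Union>H"
  proof (intro equalityI subsetI)
    fix S assume "S \<in> shadow n 2 H"
    then obtain E where "card S = 1" "E \<in> H" "S \<subset> E"
      by (auto simp: shadow_def nsets_def)
    then show "S \<in> (\<lambda>v. {v}) ` \<Union>H"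
      by (auto simp: card_1_singleton_iff)
  next
    fix S assume "S \<in> (\<lambda>v. {v}) ` \<Union>H"
    then obtain v E where vE: "S = {v}" "E \<in> H" "v \<in> E" by blast
    then have "card E = 2" "v \<in> {1..n}"
      using uniform_hypergraphD[OF assms] by auto
    moreover from this vE have "{v} \<subset> E" by auto
    ultimately show "S \<in> shadow n 2 H"
      using vE by (auto simp: shadow_def nsets_def)
  qed
  then show ?thesis by (simp add: card_image)
qed

lemma degree_le_degree_bound:
  assumes "degree_bound n H d" "v \<in> {1..n}"
  shows "real (degree H v) \<le> d"
proof -
  have "degree H v \<le> max_degree n H"
    unfolding max_degree_def using assms(2) by (intro Max_ge) auto
  then show ?thesis
    using assms(1) by (simp add: degree_bound_def)
qed

theorem proposition1p1:
  fixes d :: real and n :: nat and H :: "nat set set"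
  assumes "d \<ge> 1"
    and "uniform_hypergraph n 2 H"
    and "H \<noteq> {}"
    and "degree_bound n H d"
  shows "real (card (shadow n 2 H)) / real (card H) \<ge> 2 / d"
proof -
  note H = uniform_hypergraphD[OF assms(2)]
  have "2 * real (card H) = (\<Sum>v\<in>\<Union>H. real (degree H v))"
    using arg_cong[OF sum_degree_uniform[OF assms(2)], of real] by simp
  also have "\<dots> \<le> real (card (\<Union>H)) * d"
    using H(2) degree_le_degree_bound[OF assms(4)] by (intro sum_bounded_above) auto
  also have "\<dots> = real (card (shadow n 2 H)) * d"
    by (simp add: card_shadow_graph[OF assms(2)])
  finally have "2 * real (card H) \<le> real (card (shadow n 2 H)) * d" .
  moreover have "card H > 0"
    using H(1) assms(3) by (simp add: card_gt_0_iff)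
  ultimately show ?thesis
    using assms(1) by (simp add: divide_simps mult.commute)
qed

end
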